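(* Any limit point of the variables $(\bm\alpha^{(l)},\bm\beta^{(l)},\bm\lambda^{(l)},a^{(l)},b^{(l)})$ in the iteration of the GAS-II algorithm (see context) is a coordinatewise maximum point of the dual problem $$\max_{\bm\alpha,\bm\beta,\bm\lambda,a,b}\; -\varepsilon\sum_{i=1}^{N}\sum_{j=1}^{N}\eta_{ij}\ln(1+\rho_{ij})-\varepsilon\sum_{i=1}^{N}t_1\phi_i-\varepsilon\sum_{i=1}^{N}t_2\frac{1}{\xi_i}-\sum_{i=1}^{N}\alpha_i\overline{u}_i-\sum_{i=1}^{N}\beta_i\hat{u}_i-\sum_{j=1}^{N}\lambda_jv_j-ak_1-bk_2,$$ where $t_1=e^{-a/\varepsilon}$, $t_2=e^{-b/\varepsilon}$, $\phi_i=e^{-\alpha_i/\varepsilon}$, $\xi_i=e^{-\beta_i/\varepsilon}$, $\psi_j=e^{-\lambda_j/\varepsilon}$, $K_{ij}=e^{-C_{ij}/\varepsilon}$ and $\rho_{ij}=\phi_i\xi_iK_{ij}\psi_j$.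
   Context: Data: an integer $N$, a regularization parameter $\varepsilon>0$, a cost matrix $(C_{ij})\in\mathbb{R}^{N\times N}$, capacities $\eta_{ij}$, lower and upper production bounds $\hat u_i,\overline u_i$ ($i=1,\dots,N$), and demands $v_j$ ($j=1,\dots,N$). The optimal production transport problem is to minimize $\sum_{i,j}C_{ij}\gamma_{ij}$ over $\bm\gamma\in\mathbb{R}^{N\times N}$ and $\bm u\in\mathbb{R}^N$ subject to $\sum_j\gamma_{ij}=u_i$, $\sum_i\gamma_{ij}=v_j$, $0\le\gamma_{ij}\le\eta_{ij}$, $\hat u_i\le u_i\le\overline u_i$; its feasible set is assumed non-empty. Since the total mass $\sum_{i,j}\gamma_{ij}=\sum_jv_j$ is fixed, put $k_1=\sum_i\overline u_i-\sum_jv_j$ and $k_2=\sum_jv_j-\sum_i\hat u_i$. The regularized problem with slack variables $\bm z,\bm w$ is $$\min_{\bm\gamma,\bm z,\bm w}\ \sum_{i,j}\bigl(C_{ij}\gamma_{ij}+\varepsilon\gamma_{ij}\ln\gamma_{ij}+\varepsilon(\eta_{ij}-\gamma_{ij})\ln(\eta_{ij}-\gamma_{ij})\bigr)+\sum_i\varepsilon z_i(\ln z_i-1)+\sum_i\varepsilon w_i(\ln w_i-1)$$ subject to $\sum_j\gamma_{ij}+z_i=\overline u_i$, $\sum_j\gamma_{ij}-w_i=\hat u_i$, $\sum_i\gamma_{ij}=v_j$, $\sum_iz_i=k_1$, $\sum_iw_i=k_2$, with respective Lagrange multipliers $\alpha_i,\beta_i,\lambda_j,a,b$ (so $\bm\alpha,\bm\beta,\bm\lambda\in\mathbb{R}^N$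 and $a,b\in\mathbb{R}$). The dual problem in the claim is the Lagrangian dual of this problem; stationarity of the Lagrangian in the primal variables gives $\gamma_{ij}=\eta_{ij}\rho_{ij}/(1+\rho_{ij})$, $z_i=t_1\phi_i$, $w_i=t_2/\xi_i$. GAS-II (Generalized Alternating Sinkhorn-II) algorithm. It works with positive variables $\bm s\in\mathbb{R}^N$, $\bm\psi\in\mathbb{R}^N$, $T\in\mathbb{R}$. If $\sum_j\eta_{ij}<\hat u_i$ or $\overline u_i<\hat u_i$ for some $i$, or $\sum_i\eta_{ij}<v_j$ for some $j$, it returns "no feasible solution". Otherwise it starts from $s_i=1/N$, $\psi_j=1/N$, $T=1$, and each iteration performs successively the following three steps, always using the most recent values of the other variables (each single-variable equation being solved by Newton's method): (1) for $i=1,\dots,N$, solve for $s_i$: $\ \sum_{j=1}^N\frac{\eta_{ij}}{1+s_iK_{ij}\psi_j}-\sum_{j=1}^N\eta_{ij}+\frac{\overline u_i-\hat u_i}{Ts_i+1}+\hat u_i=0$; (2) for $j=1,\dots,N$, solve for $\psi_j$: $\ \sum_{i=1}^N\frac{\eta_{ij}}{1+s_iK_{ij}\psi_j}-\sum_{i=1}^N\eta_{ij}+v_j=0$; (3) solve for $T$: $\ \sum_{i=1}^N\frac{\overline u_i-\hat u_i}{Ts_i+1}-k_2=0$. The primal variables are recovered by $\gamma_{ij}=\frac{s_iK_{ij}\psi_j\eta_{ij}}{1+s_iK_{ij}\psi_j}$, $z_i=\frac{Ts_i(\overline u_i-\hat u_i)}{Ts_i+1}$, $w_i=\frac{\overline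 u_i-\hat u_i}{Ts_i+1}$. The variables $(\bm\alpha^{(l)},\bm\beta^{(l)},\bm\lambda^{(l)},a^{(l)},b^{(l)})$ are the dual variables at the $l$-th iteration of this algorithm; they correspond to the variables of the algorithm through $s_i=\phi_i\xi_i$, $\psi_j=e^{-\lambda_j/\varepsilon}$, $T=t_1/t_2$, with $z_i=t_1\phi_i$ and $w_i=t_2/\xi_i$. A limit point of a sequence is the limit of some subsequence. A coordinatewise maximum point of the dual objective is a point at which the objective cannot be increased by changing only one of the blocks $\bm\alpha$, $\bm\beta$, $(\bm\lambda,a,b)$ while keeping the others fixed. *)

theory Defs
  imports "HOL-Analysis.Analysis"
begin

text \<open>
  The index set \<open>{1, ..., N}\<close> is the finite type \<open>'n\<close>, so \<open>N = CARD('n)\<close>. Throughout, \<open>ulo\<close> and \<open>uup\<close>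
  are the lower and upper production bounds.
\<close>

definition feasible_set ::
  "real^'n^'n \<Rightarrow> real^'n \<Rightarrow> real^'n \<Rightarrow> real^'n \<Rightarrow> ((real^'n^'n) \<times> (real^'n)) set" where
  "feasible_set \<eta> ulo uup v = {(\<gamma>, u).
     (\<forall>i. (\<Sum>j\<in>UNIV. \<gamma> $ i $ j) = u $ i) \<and>
     (\<forall>j. (\<Sum>i\<in>UNIV. \<gamma> $ i $ j) = v $ j) \<and>
     (\<forall>i j. 0 \<le> \<gamma> $ i $ j \<and> \<gamma> $ i $ j \<le> \<eta> $ i $ j) \<and>
     (\<forall>i. ulo $ i \<le> u $ i \<and> u $ i \<le> uup $ i)}"

definition k1 :: "real^'n \<Rightarrow> real^'n \<Rightarrow> real" where
  "k1 uup v = (\<Sum>i\<in>UNIV. uup $ i) - (\<Sum>j\<in>UNIV. v $ j)"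

definition k2 :: "real^'n \<Rightarrow> real^'n \<Rightarrow> real" where
  "k2 ulo v = (\<Sum>j\<in>UNIV. v $ j) - (\<Sum>i\<in>UNIV. ulo $ i)"

definition Kmat :: "real \<Rightarrow> real^'n^'n \<Rightarrow> real^'n^'n" where
  "Kmat \<epsilon> C = (\<chi> i j. exp (- (C $ i $ j) / \<epsilon>))"

text \<open>
  The exponentials of the multipliers: \<open>\<phi>\<close>, \<open>\<xi>\<close>, \<open>\<psi>\<close> are \<open>expvec \<epsilon>\<close> of \<open>\<alpha>\<close>, \<open>\<beta>\<close>, \<open>lam\<close>,
  and \<open>t\<^sub>1\<close>, \<open>t\<^sub>2\<close> are \<open>exp (- a / \<epsilon>)\<close>, \<open>exp (- b / \<epsilon>)\<close>.
\<close>

definition expvec :: "real \<Rightarrow> real^'n \<Rightarrow> real^'n" where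
  "expvec \<epsilon> x = (\<chi> i. exp (- (x $ i) / \<epsilon>))"

text \<open>
  The Lagrangian dual function of the regularized problem, up to the additive constant
  \<open>\<epsilon> * (\<Sum>i j. \<eta>\<^sub>i\<^sub>j * ln \<eta>\<^sub>i\<^sub>j)\<close>, which does not depend on the multipliers.
\<close>

definition dual_objective ::
  "real \<Rightarrow> real^'n^'n \<Rightarrow> real^'n^'n \<Rightarrow> real^'n \<Rightarrow> real^'n \<Rightarrow> real^'n \<Rightarrow>
   real^'n \<Rightarrow> real^'n \<Rightarrow> real^'n \<Rightarrow> real \<Rightarrow> real \<Rightarrow> real" where
  "dual_objective \<epsilon> C \<eta> ulo uup v \<alpha> \<beta> lam a b =
    (let t1 = exp (- a / \<epsilon>); t2 = exp (- b / \<epsilon>);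
         \<phi> = expvec \<epsilon> \<alpha>; \<xi> = expvec \<epsilon> \<beta>; \<psi> = expvec \<epsilon> lam;
         \<rho> = (\<lambda>i j. \<phi> $ i * \<xi> $ i * Kmat \<epsilon> C $ i $ j * \<psi> $ j)
     in - \<epsilon> * (\<Sum>i\<in>UNIV. \<Sum>j\<in>UNIV. \<eta> $ i $ j * ln (1 + \<rho> i j))
        - \<epsilon> * (\<Sum>i\<in>UNIV. t1 * \<phi> $ i)
        - \<epsilon> * (\<Sum>i\<in>UNIV. t2 * (1 / \<xi> $ i))
        - (\<Sum>i\<in>UNIV. \<alpha> $ i * uup $ i)
        - (\<Sum>i\<in>UNIV. \<beta> $ i * ulo $ i)
        - (\<Sum>j\<in>UNIV. lam $ j * v $ j)
        - a * k1 uup v - b * k2 ulo v)"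

definition coordinatewise_max ::
  "(real^'n \<Rightarrow> real^'n \<Rightarrow> real^'n \<Rightarrow> real \<Rightarrow> real \<Rightarrow> real) \<Rightarrow>
   real^'n \<Rightarrow> real^'n \<Rightarrow> real^'n \<Rightarrow> real \<Rightarrow> real \<Rightarrow> bool" where
  "coordinatewise_max D \<alpha> \<beta> lam a b \<longleftrightarrow>
     (\<forall>\<alpha>'. D \<alpha>' \<beta> lam a b \<le> D \<alpha> \<beta> lam a b) \<and>
     (\<forall>\<beta>'. D \<alpha> \<beta>' lam a b \<le> D \<alpha> \<beta> lam a b) \<and>
     (\<forall>lam' a' b'. D \<alpha> \<beta> lam' a' b' \<le> D \<alpha> \<beta> lam a b)"

definition gas2_rejects :: "real^'n^'n \<Rightarrow> real^'n \<Rightarrow> real^'n \<Rightarrow> real^'n \<Rightarrow> bool" where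
  "gas2_rejects \<eta> ulo uup v \<longleftrightarrow>
     (\<exists>i. (\<Sum>j\<in>UNIV. \<eta> $ i $ j) < ulo $ i) \<or>
     (\<exists>i. uup $ i < ulo $ i) \<or>
     (\<exists>j. (\<Sum>i\<in>UNIV. \<eta> $ i $ j) < v $ j)"

text \<open>
  A run of GAS-II: \<open>(s l, \<psi> l, T l)\<close> is the state after \<open>l\<close> iterations, and every single-variable
  equation is solved exactly in the positive reals. The equations for different \<open>i\<close> in the
  \<open>s\<close>-step are decoupled, as are those for different \<open>j\<close> in the \<open>\<psi>\<close>-step.
\<close>

definition gas2_run ::
  "real \<Rightarrow> real^'n^'n \<Rightarrow> real^'n^'n \<Rightarrow> real^'n \<Rightarrow> real^'n \<Rightarrow> real^'n \<Rightarrow>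
   (nat \<Rightarrow> real^'n) \<Rightarrow> (nat \<Rightarrow> real^'n) \<Rightarrow> (nat \<Rightarrow> real) \<Rightarrow> bool" where
  "gas2_run \<epsilon> C \<eta> ulo uup v s \<psi> T \<longleftrightarrow>
     \<not> gas2_rejects \<eta> ulo uup v \<and>
     s 0 = (\<chi> i. 1 / real CARD('n)) \<and> \<psi> 0 = (\<chi> j. 1 / real CARD('n)) \<and> T 0 = 1 \<and>
     (\<forall>l.
       (\<forall>i. s (Suc l) $ i > 0 \<and>
          (\<Sum>j\<in>UNIV. \<eta> $ i $ j / (1 + s (Suc l) $ i * Kmat \<epsilon> C $ i $ j * \<psi> l $ j))
            - (\<Sum>j\<in>UNIV. \<eta> $ i $ j)
            + (uup $ i - ulo $ i) / (T l * s (Suc l) $ i + 1) + ulo $ i = 0) \<and>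
       (\<forall>j. \<psi> (Suc l) $ j > 0 \<and>
          (\<Sum>i\<in>UNIV. \<eta> $ i $ j / (1 + s (Suc l) $ i * Kmat \<epsilon> C $ i $ j * \<psi> (Suc l) $ j))
            - (\<Sum>i\<in>UNIV. \<eta> $ i $ j) + v $ j = 0) \<and>
       T (Suc l) > 0 \<and>
       (\<Sum>i\<in>UNIV. (uup $ i - ulo $ i) / (T (Suc l) * s (Suc l) $ i + 1)) - k2 ulo v = 0)"

definition gas2_z :: "real^'n \<Rightarrow> real^'n \<Rightarrow> real^'n \<Rightarrow> real \<Rightarrow> real^'n" where
  "gas2_z ulo uup s T = (\<chi> i. T * s $ i * (uup $ i - ulo $ i) / (T * s $ i + 1))"

definition gas2_w :: "real^'n \<Rightarrow> real^'n \<Rightarrow> real^'n \<Rightarrow> real \<Rightarrow> real^'n" where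
  "gas2_w ulo uup s T = (\<chi> i. (uup $ i - ulo $ i) / (T * s $ i + 1))"

text \<open>
  The correspondence between the algorithm's variables and the dual variables. It fixes
  \<open>(\<alpha>, \<beta>, lam, a, b)\<close> only up to the shift \<open>(\<alpha> + c, \<beta> - c, lam, a - c, b - c)\<close>,
  under which the dual objective is invariant. Since \<open>t\<^sub>1 * \<phi>\<^sub>i > 0\<close>, it forces \<open>ulo < uup\<close>
  componentwise: if \<open>ulo\<^sub>i = uup\<^sub>i\<close>, then \<open>z\<^sub>i = w\<^sub>i = 0\<close> and no real multipliers correspond.
\<close>

definition gas2_dual_variables ::
  "real \<Rightarrow> real^'n \<Rightarrow> real^'n \<Rightarrow> real^'n \<Rightarrow> real^'n \<Rightarrow> real \<Rightarrow>
   real^'n \<Rightarrow> real^'n \<Rightarrow> real^'n \<Rightarrow> real \<Rightarrow> real \<Rightarrow> bool" where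
  "gas2_dual_variables \<epsilon> ulo uup s \<psi> T \<alpha> \<beta> lam a b \<longleftrightarrow>
    (let t1 = exp (- a / \<epsilon>); t2 = exp (- b / \<epsilon>); \<phi> = expvec \<epsilon> \<alpha>; \<xi> = expvec \<epsilon> \<beta>
     in (\<forall>i. s $ i = \<phi> $ i * \<xi> $ i) \<and> \<psi> = expvec \<epsilon> lam \<and> T = t1 / t2 \<and>
        (\<forall>i. gas2_z ulo uup s T $ i = t1 * \<phi> $ i) \<and>
        (\<forall>i. gas2_w ulo uup s T $ i = t2 / \<xi> $ i))"

end

theory Submission
  imports Defs
begin

text \<open>
  Since \<open>\<eta> \<ge> 0\<close>, the dual objective \<open>D\<close> is concave, and its partial derivatives are the residuals of
  the primal constraints at the minimizer of the Lagrangian. Reading the residuals off the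
  equations of the algorithm identifies each step with an exact maximization of \<open>D\<close>.

  \<^item> The \<open>s\<close>-step maximizes \<open>D\<close> jointly over \<open>(\<alpha>, \<beta>)\<close>, with \<open>(lam, a, b)\<close> fixed: the two stationarity
    conditions for index \<open>i\<close> say that \<open>z\<^sub>i + w\<^sub>i = uup\<^sub>i - ulo\<^sub>i\<close> and that row \<open>i\<close> of the flow has sum
    \<open>w\<^sub>i + ulo\<^sub>i\<close>; as \<open>z\<^sub>i = T * s\<^sub>i * w\<^sub>i\<close>, eliminating \<open>z\<^sub>i\<close> and \<open>w\<^sub>i\<close> leaves the equation for \<open>s\<^sub>i\<close>.
  \<^item> The \<open>\<psi>\<close>-step and the \<open>T\<close>-step together maximize \<open>D\<close> over \<open>(lam, a, b)\<close> and over all changes of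
    \<open>(\<alpha>, \<beta>)\<close> that keep \<open>\<alpha> + \<beta>\<close>, that is \<open>s\<close>, fixed. Indeed the recovered slacks satisfy
    \<open>z\<^sub>i + w\<^sub>i = uup\<^sub>i - ulo\<^sub>i\<close> by construction, and this makes the derivatives with respect to \<open>\<alpha>\<^sub>i\<close> and
    \<open>\<beta>\<^sub>i\<close> equal. The \<open>T\<close>-equation makes the slacks \<open>w\<^sub>i\<close> sum to \<open>k2\<close>, hence the slacks \<open>z\<^sub>i\<close> to \<open>k1\<close>.

  Let \<open>l \<ge> 1\<close> and write \<open>D\<^sub>l\<close> for the value of \<open>D\<close> after iteration \<open>l\<close>. Chaining the two observations
  (lemmas \<open>s_step_maximizes\<close> and \<open>psi_T_steps_maximize\<close>) gives
  \<open>D \<alpha> \<beta> (lam l) (a l) (b l) \<le> D\<^sub>l\<^sub>+\<^sub>1\<close> for all \<open>\<alpha>\<close> and \<open>\<beta>\<close>. In particular \<open>D\<^sub>l\<close> increases with \<open>l\<close>, so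
  it never exceeds the value of \<open>D\<close> at a limit point. Passing to the limit along the subsequence on
  the left-hand side shows that the limit point maximizes \<open>D\<close> over \<open>(\<alpha>, \<beta>)\<close> jointly, a stronger
  property than maximality in \<open>\<alpha>\<close> and in \<open>\<beta>\<close> separately. Maximality in \<open>(lam, a, b)\<close> holds at every
  iterate with \<open>l \<ge> 1\<close> and passes to the limit by continuity of \<open>D\<close>.
\<close>

section \<open>Concavity of the dual objective\<close>

text \<open>
  The function \<open>x \<mapsto> ln (1 + exp x)\<close> is convex because its derivative, the logistic function, is
  increasing; this is its tangent inequality.
\<close>

lemma ln_one_plus_exp_above_tangent:
  fixes x y :: real
  shows "ln (1 + exp x) + exp x / (1 + exp x) * (y - x) \<le> ln (1 + exp y)"
proof -
  have pos: "1 + exp t > 0" for t :: real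
    by (simp add: add_pos_pos)
  have deriv: "((\<lambda>t. ln (1 + exp t)) has_real_derivative exp t / (1 + exp t)) (at t)" for t :: real
    using pos[of t] by (auto intro!: derivative_eq_intros simp: field_simps)
  have mono: "exp p / (1 + exp p) \<le> exp q / (1 + exp q)" if "p \<le> q" for p q :: real
    using that pos[of p] pos[of q] by (simp add: field_simps)
  have "convex_on UNIV (\<lambda>t::real. ln (1 + exp t))"
    by (rule convex_on_realI[OF _ deriv mono]) auto
  then have "exp x / (1 + exp x) * (y - x) \<le> ln (1 + exp y) - ln (1 + exp x)"
    by (rule convex_on_imp_above_tangent) (use deriv in auto)
  then show ?thesis by simp
qed

lemma exp_above_tangent:
  fixes x y :: real
  shows "exp x + exp x * (y - x) \<le> exp y"
proof -
  have "exp x * (1 + (y - x)) \<le> exp x * exp (y - x)"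
    by (intro mult_left_mono exp_ge_add_one_self) simp
  then show ?thesis by (simp add: exp_diff algebra_simps)
qed

text \<open>
  The minimizer \<open>(\<gamma>, z, w)\<close> of the Lagrangian for given multipliers, where the exponent
  \<open>- (\<alpha>\<^sub>i + \<beta>\<^sub>i + C\<^sub>i\<^sub>j + lam\<^sub>j) / \<epsilon>\<close> is \<open>ln \<rho>\<^sub>i\<^sub>j\<close>.
\<close>

definition log_rho :: "real \<Rightarrow> real^'n^'n \<Rightarrow> real^'n \<Rightarrow> real^'n \<Rightarrow> real^'n \<Rightarrow> 'n \<Rightarrow> 'n \<Rightarrow> real" where
  "log_rho \<epsilon> C \<alpha> \<beta> lam i j = - (\<alpha> $ i + \<beta> $ i + C $ i $ j + lam $ j) / \<epsilon>"

definition flow ::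
  "real \<Rightarrow> real^'n^'n \<Rightarrow> real^'n^'n \<Rightarrow> real^'n \<Rightarrow> real^'n \<Rightarrow> real^'n \<Rightarrow> 'n \<Rightarrow> 'n \<Rightarrow> real" where
  "flow \<epsilon> C \<eta> \<alpha> \<beta> lam i j =
     \<eta> $ i $ j * (exp (log_rho \<epsilon> C \<alpha> \<beta> lam i j) / (1 + exp (log_rho \<epsilon> C \<alpha> \<beta> lam i j)))"

definition upper_slack :: "real \<Rightarrow> real^'n \<Rightarrow> real \<Rightarrow> 'n \<Rightarrow> real" where
  "upper_slack \<epsilon> \<alpha> a i = exp (- (a + \<alpha> $ i) / \<epsilon>)"

definition lower_slack :: "real \<Rightarrow> real^'n \<Rightarrow> real \<Rightarrow> 'n \<Rightarrow> real" where
  "lower_slack \<epsilon> \<beta> b i = exp ((\<beta> $ i - b) / \<epsilon>)"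

lemma rho_eq_exp_log_rho:
  "expvec \<epsilon> \<alpha> $ i * expvec \<epsilon> \<beta> $ i * Kmat \<epsilon> C $ i $ j * expvec \<epsilon> lam $ j
     = exp (log_rho \<epsilon> C \<alpha> \<beta> lam i j)"
  by (simp add: expvec_def Kmat_def log_rho_def exp_add[symmetric] add_divide_distrib diff_divide_distrib)

lemma upper_slack_eq: "exp (- a / \<epsilon>) * expvec \<epsilon> \<alpha> $ i = upper_slack \<epsilon> \<alpha> a i"
  by (simp add: expvec_def upper_slack_def exp_add[symmetric] add_divide_distrib diff_divide_distrib)

lemma lower_slack_eq: "exp (- b / \<epsilon>) / expvec \<epsilon> \<beta> $ i = lower_slack \<epsilon> \<beta> b i"
  by (simp add: expvec_def lower_slack_def exp_diff[symmetric] diff_divide_distrib)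

lemma dual_objective_eq:
  "dual_objective \<epsilon> C \<eta> ulo uup v \<alpha> \<beta> lam a b =
     - \<epsilon> * (\<Sum>i\<in>UNIV. \<Sum>j\<in>UNIV. \<eta> $ i $ j * ln (1 + exp (log_rho \<epsilon> C \<alpha> \<beta> lam i j)))
     - \<epsilon> * (\<Sum>i\<in>UNIV. upper_slack \<epsilon> \<alpha> a i) - \<epsilon> * (\<Sum>i\<in>UNIV. lower_slack \<epsilon> \<beta> b i)
     - (\<Sum>i\<in>UNIV. \<alpha> $ i * uup $ i) - (\<Sum>i\<in>UNIV. \<beta> $ i * ulo $ i) - (\<Sum>j\<in>UNIV. lam $ j * v $ j)
     - a * k1 uup v - b * k2 ulo v"
  unfolding dual_objective_def Let_def rho_eq_exp_log_rho upper_slack_eq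
    times_divide_eq_right mult_1_right lower_slack_eq by (rule refl)

text \<open>
  Concavity in the form of a supergradient inequality. The coefficients of the linear term are the
  residuals of the five primal constraints, as for every Lagrangian dual.
\<close>

lemma dual_objective_supergradient:
  assumes "\<epsilon> > 0" and \<eta>: "\<And>i j. \<eta> $ i $ j \<ge> 0"
  shows "dual_objective \<epsilon> C \<eta> ulo uup v \<alpha>' \<beta>' lam' a' b'
    \<le> dual_objective \<epsilon> C \<eta> ulo uup v \<alpha> \<beta> lam a b
      + (\<Sum>i\<in>UNIV. ((\<Sum>j\<in>UNIV. flow \<epsilon> C \<eta> \<alpha> \<beta> lam i j) + upper_slack \<epsilon> \<alpha> a i - uup $ i) * (\<alpha>' $ i - \<alpha> $ i))
      + (\<Sum>i\<in>UNIV. ((\<Sum>j\<in>UNIV. flow \<epsilon> C \<eta> \<alpha> \<beta> lam i j) - lower_slack \<epsilon> \<beta> b i - ulo $ i) * (\<beta>' $ i - \<beta> $ i))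
      + (\<Sum>j\<in>UNIV. ((\<Sum>i\<in>UNIV. flow \<epsilon> C \<eta> \<alpha> \<beta> lam i j) - v $ j) * (lam' $ j - lam $ j))
      + ((\<Sum>i\<in>UNIV. upper_slack \<epsilon> \<alpha> a i) - k1 uup v) * (a' - a)
      + ((\<Sum>i\<in>UNIV. lower_slack \<epsilon> \<beta> b i) - k2 ulo v) * (b' - b)"
proof -
  let ?\<gamma> = "flow \<epsilon> C \<eta> \<alpha> \<beta> lam"
  let ?z = "upper_slack \<epsilon> \<alpha> a" and ?w = "lower_slack \<epsilon> \<beta> b"
  have flow_term:
    "- \<epsilon> * (\<eta> $ i $ j * ln (1 + exp (log_rho \<epsilon> C \<alpha>' \<beta>' lam' i j)))
      \<le> - \<epsilon> * (\<eta> $ i $ j * ln (1 + exp (log_rho \<epsilon> C \<alpha> \<beta> lam i j)))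
        + ?\<gamma> i j * (\<alpha>' $ i - \<alpha> $ i) + ?\<gamma> i j * (\<beta>' $ i - \<beta> $ i) + ?\<gamma> i j * (lam' $ j - lam $ j)" for i j
  proof -
    let ?x = "log_rho \<epsilon> C \<alpha> \<beta> lam i j" and ?y = "log_rho \<epsilon> C \<alpha>' \<beta>' lam' i j"
    let ?p = "exp ?x / (1 + exp ?x)"
    have "\<epsilon> * \<eta> $ i $ j * (ln (1 + exp ?x) + ?p * (?y - ?x)) \<le> \<epsilon> * \<eta> $ i $ j * ln (1 + exp ?y)"
      using assms by (intro mult_left_mono ln_one_plus_exp_above_tangent) auto
    moreover have "\<epsilon> * (?y - ?x)
        = - ((\<alpha>' $ i - \<alpha> $ i) + (\<beta>' $ i - \<beta> $ i) + (lam' $ j - lam $ j))"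
      using \<open>\<epsilon> > 0\<close> by (simp add: log_rho_def field_simps)
    then have "\<epsilon> * \<eta> $ i $ j * (?p * (?y - ?x))
        = \<eta> $ i $ j * ?p * - ((\<alpha>' $ i - \<alpha> $ i) + (\<beta>' $ i - \<beta> $ i) + (lam' $ j - lam $ j))"
      by (metis (no_types, opaque_lifting) mult.assoc mult.left_commute)
    ultimately show ?thesis
      unfolding flow_def by (simp only: distrib_left mult_minus_right mult.assoc)
  qed
  have upper_term: "- \<epsilon> * upper_slack \<epsilon> \<alpha>' a' i
      \<le> - \<epsilon> * ?z i + ?z i * (\<alpha>' $ i - \<alpha> $ i) + ?z i * (a' - a)" for i
  proof -
    have "\<epsilon> * (?z i + ?z i * (- (a' + \<alpha>' $ i) / \<epsilon> - - (a + \<alpha> $ i) / \<epsilon>)) \<le> \<epsilon> * upper_slack \<epsilon> \<alpha>' a' i"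
      unfolding upper_slack_def using \<open>\<epsilon> > 0\<close> by (intro mult_left_mono exp_above_tangent) auto
    moreover have "\<epsilon> * (?z i + ?z i * (- (a' + \<alpha>' $ i) / \<epsilon> - - (a + \<alpha> $ i) / \<epsilon>))
        = \<epsilon> * ?z i - ?z i * (\<alpha>' $ i - \<alpha> $ i) - ?z i * (a' - a)"
      using \<open>\<epsilon> > 0\<close> by (simp add: field_simps)
    ultimately show ?thesis by simp
  qed
  have lower_term: "- \<epsilon> * lower_slack \<epsilon> \<beta>' b' i
      \<le> - \<epsilon> * ?w i - ?w i * (\<beta>' $ i - \<beta> $ i) + ?w i * (b' - b)" for i
  proof -
    have "\<epsilon> * (?w i + ?w i * ((\<beta>' $ i - b') / \<epsilon> - (\<beta> $ i - b) / \<epsilon>)) \<le> \<epsilon> * lower_slack \<epsilon> \<beta>' b' i"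
      unfolding lower_slack_def using \<open>\<epsilon> > 0\<close> by (intro mult_left_mono exp_above_tangent) auto
    moreover have "\<epsilon> * (?w i + ?w i * ((\<beta>' $ i - b') / \<epsilon> - (\<beta> $ i - b) / \<epsilon>))
        = \<epsilon> * ?w i + ?w i * (\<beta>' $ i - \<beta> $ i) - ?w i * (b' - b)"
      using \<open>\<epsilon> > 0\<close> by (simp add: field_simps)
    ultimately show ?thesis by simp
  qed
  have "(\<Sum>i\<in>UNIV. \<Sum>j\<in>UNIV. ?\<gamma> i j * (lam' $ j - lam $ j))
      = (\<Sum>j\<in>UNIV. (\<Sum>i\<in>UNIV. ?\<gamma> i j) * (lam' $ j - lam $ j))"
    by (subst sum.swap) (simp add: sum_distrib_right)
  moreover have "(\<Sum>i\<in>UNIV. \<Sum>j\<in>UNIV. - \<epsilon> * (\<eta> $ i $ j * ln (1 + exp (log_rho \<epsilon> C \<alpha>' \<beta>' lam' i j))))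
      \<le> (\<Sum>i\<in>UNIV. \<Sum>j\<in>UNIV. - \<epsilon> * (\<eta> $ i $ j * ln (1 + exp (log_rho \<epsilon> C \<alpha> \<beta> lam i j)))
        + ?\<gamma> i j * (\<alpha>' $ i - \<alpha> $ i) + ?\<gamma> i j * (\<beta>' $ i - \<beta> $ i) + ?\<gamma> i j * (lam' $ j - lam $ j))"
    by (intro sum_mono flow_term)
  ultimately have flows:
    "- \<epsilon> * (\<Sum>i\<in>UNIV. \<Sum>j\<in>UNIV. \<eta> $ i $ j * ln (1 + exp (log_rho \<epsilon> C \<alpha>' \<beta>' lam' i j)))
      \<le> - \<epsilon> * (\<Sum>i\<in>UNIV. \<Sum>j\<in>UNIV. \<eta> $ i $ j * ln (1 + exp (log_rho \<epsilon> C \<alpha> \<beta> lam i j)))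
        + (\<Sum>i\<in>UNIV. (\<Sum>j\<in>UNIV. ?\<gamma> i j) * (\<alpha>' $ i - \<alpha> $ i))
        + (\<Sum>i\<in>UNIV. (\<Sum>j\<in>UNIV. ?\<gamma> i j) * (\<beta>' $ i - \<beta> $ i))
        + (\<Sum>j\<in>UNIV. (\<Sum>i\<in>UNIV. ?\<gamma> i j) * (lam' $ j - lam $ j))"
    by (simp add: sum.distrib sum_distrib_left sum_distrib_right sum_negf sum_subtractf)
  have "(\<Sum>i\<in>UNIV. - \<epsilon> * upper_slack \<epsilon> \<alpha>' a' i) \<le> (\<Sum>i\<in>UNIV. - \<epsilon> * ?z i + ?z i * (\<alpha>' $ i - \<alpha> $ i) + ?z i * (a' - a))"
    by (intro sum_mono upper_term)
  then have uppers: "- \<epsilon> * (\<Sum>i\<in>UNIV. upper_slack \<epsilon> \<alpha>' a' i)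
      \<le> - \<epsilon> * (\<Sum>i\<in>UNIV. ?z i) + (\<Sum>i\<in>UNIV. ?z i * (\<alpha>' $ i - \<alpha> $ i)) + (\<Sum>i\<in>UNIV. ?z i) * (a' - a)"
    by (simp add: sum.distrib sum_distrib_left sum_distrib_right sum_negf sum_subtractf)
  have "(\<Sum>i\<in>UNIV. - \<epsilon> * lower_slack \<epsilon> \<beta>' b' i) \<le> (\<Sum>i\<in>UNIV. - \<epsilon> * ?w i - ?w i * (\<beta>' $ i - \<beta> $ i) + ?w i * (b' - b))"
    by (intro sum_mono lower_term)
  then have lowers: "- \<epsilon> * (\<Sum>i\<in>UNIV. lower_slack \<epsilon> \<beta>' b' i)
      \<le> - \<epsilon> * (\<Sum>i\<in>UNIV. ?w i) - (\<Sum>i\<in>UNIV. ?w i * (\<beta>' $ i - \<beta> $ i)) + (\<Sum>i\<in>UNIV. ?w i) * (b' - b)"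
    by (simp add: sum.distrib sum_distrib_left sum_distrib_right sum_negf sum_subtractf)
  have "(\<Sum>i\<in>UNIV. ((\<Sum>j\<in>UNIV. ?\<gamma> i j) + ?z i - uup $ i) * (\<alpha>' $ i - \<alpha> $ i))
      = (\<Sum>i\<in>UNIV. (\<Sum>j\<in>UNIV. ?\<gamma> i j) * (\<alpha>' $ i - \<alpha> $ i)) + (\<Sum>i\<in>UNIV. ?z i * (\<alpha>' $ i - \<alpha> $ i))
        - ((\<Sum>i\<in>UNIV. \<alpha>' $ i * uup $ i) - (\<Sum>i\<in>UNIV. \<alpha> $ i * uup $ i))"
    unfolding sum.distrib[symmetric] sum_subtractf[symmetric]
    by (rule sum.cong) (simp_all only: algebra_simps)
  moreover have "(\<Sum>i\<in>UNIV. ((\<Sum>j\<in>UNIV. ?\<gamma> i j) - ?w i - ulo $ i) * (\<beta>' $ i - \<beta> $ i))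
      = (\<Sum>i\<in>UNIV. (\<Sum>j\<in>UNIV. ?\<gamma> i j) * (\<beta>' $ i - \<beta> $ i)) - (\<Sum>i\<in>UNIV. ?w i * (\<beta>' $ i - \<beta> $ i))
        - ((\<Sum>i\<in>UNIV. \<beta>' $ i * ulo $ i) - (\<Sum>i\<in>UNIV. \<beta> $ i * ulo $ i))"
    unfolding sum.distrib[symmetric] sum_subtractf[symmetric]
    by (rule sum.cong) (simp_all only: algebra_simps)
  moreover have "(\<Sum>j\<in>UNIV. ((\<Sum>i\<in>UNIV. ?\<gamma> i j) - v $ j) * (lam' $ j - lam $ j))
      = (\<Sum>j\<in>UNIV. (\<Sum>i\<in>UNIV. ?\<gamma> i j) * (lam' $ j - lam $ j))
        - ((\<Sum>j\<in>UNIV. lam' $ j * v $ j) - (\<Sum>j\<in>UNIV. lam $ j * v $ j))"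
    unfolding sum.distrib[symmetric] sum_subtractf[symmetric]
    by (rule sum.cong) (simp_all only: algebra_simps)
  moreover have "((\<Sum>i\<in>UNIV. ?z i) - k1 uup v) * (a' - a)
      = (\<Sum>i\<in>UNIV. ?z i) * (a' - a) - (a' * k1 uup v - a * k1 uup v)"
    by (simp only: algebra_simps)
  moreover have "((\<Sum>i\<in>UNIV. ?w i) - k2 ulo v) * (b' - b)
      = (\<Sum>i\<in>UNIV. ?w i) * (b' - b) - (b' * k2 ulo v - b * k2 ulo v)"
    by (simp only: algebra_simps)
  ultimately show ?thesis
    using flows uppers lowers unfolding dual_objective_eq by linarith
qed

text \<open>
  The stationarity conditions of the \<open>s\<close>-step. The equation \<open>z\<^sub>i + w\<^sub>i = uup\<^sub>i - ulo\<^sub>i\<close> is the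
  difference of the stationarity conditions for \<open>\<alpha>\<^sub>i\<close> and \<open>\<beta>\<^sub>i\<close>.
\<close>

lemma maximal_in_alpha_beta:
  assumes "\<epsilon> > 0" "\<And>i j. \<eta> $ i $ j \<ge> 0"
    and row: "\<And>i. (\<Sum>j\<in>UNIV. flow \<epsilon> C \<eta> \<alpha> \<beta> lam i j) = lower_slack \<epsilon> \<beta> b i + ulo $ i"
    and slack: "\<And>i. upper_slack \<epsilon> \<alpha> a i + lower_slack \<epsilon> \<beta> b i = uup $ i - ulo $ i"
  shows "dual_objective \<epsilon> C \<eta> ulo uup v \<alpha>' \<beta>' lam a b \<le> dual_objective \<epsilon> C \<eta> ulo uup v \<alpha> \<beta> lam a b"
proof -
  have "(\<Sum>j\<in>UNIV. flow \<epsilon> C \<eta> \<alpha> \<beta> lam i j) + upper_slack \<epsilon> \<alpha> a i - uup $ i = 0" for i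
    using row[of i] slack[of i] by linarith
  moreover have "(\<Sum>j\<in>UNIV. flow \<epsilon> C \<eta> \<alpha> \<beta> lam i j) - lower_slack \<epsilon> \<beta> b i - ulo $ i = 0" for i
    using row[of i] by linarith
  ultimately show ?thesis
    using dual_objective_supergradient[OF assms(1,2), of C ulo uup v \<alpha>' \<beta>' lam a b \<alpha> \<beta> lam a b]
    by simp
qed

text \<open>
  The stationarity conditions that hold after the \<open>\<psi>\<close>-step and the \<open>T\<close>-step. The slack condition
  makes the residuals for \<open>\<alpha>\<^sub>i\<close> and \<open>\<beta>\<^sub>i\<close> equal, though possibly nonzero, so opposite changes of
  \<open>\<alpha>\<^sub>i\<close> and \<open>\<beta>\<^sub>i\<close> cancel to first order.
\<close>

lemma maximal_for_fixed_alpha_plus_beta: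
  assumes "\<epsilon> > 0" "\<And>i j. \<eta> $ i $ j \<ge> 0"
    and column: "\<And>j. (\<Sum>i\<in>UNIV. flow \<epsilon> C \<eta> \<alpha> \<beta> lam i j) = v $ j"
    and slack: "\<And>i. upper_slack \<epsilon> \<alpha> a i + lower_slack \<epsilon> \<beta> b i = uup $ i - ulo $ i"
    and lower_sum: "(\<Sum>i\<in>UNIV. lower_slack \<epsilon> \<beta> b i) = k2 ulo v"
    and fixed_sum: "\<And>i. \<alpha>' $ i + \<beta>' $ i = \<alpha> $ i + \<beta> $ i"
  shows "dual_objective \<epsilon> C \<eta> ulo uup v \<alpha>' \<beta>' lam' a' b' \<le> dual_objective \<epsilon> C \<eta> ulo uup v \<alpha> \<beta> lam a b"
proof -
  let ?g = "\<lambda>i. (\<Sum>j\<in>UNIV. flow \<epsilon> C \<eta> \<alpha> \<beta> lam i j) - lower_slack \<epsilon> \<beta> b i - ulo $ i"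
  have "(\<Sum>i\<in>UNIV. upper_slack \<epsilon> \<alpha> a i) + (\<Sum>i\<in>UNIV. lower_slack \<epsilon> \<beta> b i)
      = (\<Sum>i\<in>UNIV. uup $ i) - (\<Sum>i\<in>UNIV. ulo $ i)"
    using slack by (simp add: sum.distrib[symmetric] sum_subtractf)
  then have upper_sum: "(\<Sum>i\<in>UNIV. upper_slack \<epsilon> \<alpha> a i) = k1 uup v"
    using lower_sum by (simp add: k1_def k2_def)
  have "(\<Sum>j\<in>UNIV. flow \<epsilon> C \<eta> \<alpha> \<beta> lam i j) + upper_slack \<epsilon> \<alpha> a i - uup $ i = ?g i" for i
    using slack[of i] by linarith
  moreover have "\<alpha>' $ i - \<alpha> $ i = - (\<beta>' $ i - \<beta> $ i)" for i
    using fixed_sum[of i] by linarith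
  ultimately have cancel:
    "(\<Sum>i\<in>UNIV. ((\<Sum>j\<in>UNIV. flow \<epsilon> C \<eta> \<alpha> \<beta> lam i j) + upper_slack \<epsilon> \<alpha> a i - uup $ i) * (\<alpha>' $ i - \<alpha> $ i))
      + (\<Sum>i\<in>UNIV. ?g i * (\<beta>' $ i - \<beta> $ i)) = 0"
    by (simp only: mult_minus_right sum_negf)
  show ?thesis
    using dual_objective_supergradient[OF assms(1,2), of C ulo uup v \<alpha>' \<beta>' lam' a' b' \<alpha> \<beta> lam a b] cancel
    by (simp add: column upper_sum lower_sum)
qed

lemma tendsto_dual_objective:
  assumes "\<epsilon> > 0" "(\<alpha> \<longlongrightarrow> \<alpha>') F" "(\<beta> \<longlongrightarrow> \<beta>') F" "(lam \<longlongrightarrow> lam') F" "(a \<longlongrightarrow> a') F" "(b \<longlongrightarrow> b') F"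
  shows "((\<lambda>x. dual_objective \<epsilon> C \<eta> ulo uup v (\<alpha> x) (\<beta> x) (lam x) (a x) (b x))
    \<longlongrightarrow> dual_objective \<epsilon> C \<eta> ulo uup v \<alpha>' \<beta>' lam' a' b') F"
proof -
  have "1 + exp t \<noteq> 0" for t :: real
    by (metis add_pos_pos exp_gt_zero less_irrefl zero_less_one)
  then show ?thesis
    unfolding dual_objective_eq log_rho_def upper_slack_def lower_slack_def
    using assms by (intro tendsto_intros) auto
qed

section \<open>The steps of the algorithm as block maximizations\<close>

lemma flow_eq_capacity_minus:
  assumes "s * Kmat \<epsilon> C $ i $ j * \<psi> = exp (log_rho \<epsilon> C \<alpha> \<beta> lam i j)"
  shows "flow \<epsilon> C \<eta> \<alpha> \<beta> lam i j = \<eta> $ i $ j - \<eta> $ i $ j / (1 + s * Kmat \<epsilon> C $ i $ j * \<psi>)"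
proof -
  have "1 + exp (log_rho \<epsilon> C \<alpha> \<beta> lam i j) \<noteq> 0"
    by (metis add_pos_pos exp_gt_zero less_irrefl zero_less_one)
  then show ?thesis
    unfolding flow_def assms by (simp add: field_simps)
qed

text \<open>
  The multipliers \<open>(\<alpha>, \<beta>)\<close> constructed here belong to the slacks \<open>z\<close> and \<open>w\<close> recovered from the new
  \<open>s\<close> and the old \<open>T\<close>. They need not be multipliers of any iterate, because the \<open>T\<close>-step changes
  the slacks again; they serve as the intermediate point between two iterates.
\<close>

lemma s_step_maximizes:
  fixes s :: "real^'n"
  assumes "\<epsilon> > 0" "\<And>i j. \<eta> $ i $ j \<ge> 0" and bounds: "\<And>i. ulo $ i < uup $ i"
    and s_pos: "\<And>i. s $ i > 0"
    and \<psi>: "\<psi> = expvec \<epsilon> lam" and T: "T = exp (- a / \<epsilon>) / exp (- b / \<epsilon>)"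
    and s_eq: "\<And>i. (\<Sum>j\<in>UNIV. \<eta> $ i $ j / (1 + s $ i * Kmat \<epsilon> C $ i $ j * \<psi> $ j))
        - (\<Sum>j\<in>UNIV. \<eta> $ i $ j) + (uup $ i - ulo $ i) / (T * s $ i + 1) + ulo $ i = 0"
  obtains \<alpha> \<beta> where
    "\<And>i. expvec \<epsilon> \<alpha> $ i * expvec \<epsilon> \<beta> $ i = s $ i"
    "\<And>\<alpha>' \<beta>'. dual_objective \<epsilon> C \<eta> ulo uup v \<alpha>' \<beta>' lam a b \<le> dual_objective \<epsilon> C \<eta> ulo uup v \<alpha> \<beta> lam a b"
proof -
  define w where "w i = (uup $ i - ulo $ i) / (T * s $ i + 1)" for i
  define z where "z i = T * s $ i * w i" for i
  have T_pos: "T > 0" using T by simp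
  have denom: "T * s $ i + 1 > 0" for i
    using T_pos s_pos[of i] by (simp add: add_pos_pos)
  have w_pos: "w i > 0" for i
    using denom[of i] bounds[of i] by (simp add: w_def)
  have z_pos: "z i > 0" for i
    using w_pos[of i] T_pos s_pos[of i] by (simp add: z_def)
  have "z i + w i = (T * s $ i + 1) * w i" for i
    by (simp add: z_def algebra_simps)
  then have zw: "z i + w i = uup $ i - ulo $ i" for i
    using denom[of i] by (simp add: w_def)
  define \<alpha> :: "real^'n" where "\<alpha> = (\<chi> i. - \<epsilon> * ln (z i) - a)"
  define \<beta> :: "real^'n" where "\<beta> = (\<chi> i. \<epsilon> * ln (w i) + b)"
  have upper: "upper_slack \<epsilon> \<alpha> a i = z i" for i
    using \<open>\<epsilon> > 0\<close> z_pos[of i] by (simp add: upper_slack_def \<alpha>_def)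
  have lower: "lower_slack \<epsilon> \<beta> b i = w i" for i
    using \<open>\<epsilon> > 0\<close> w_pos[of i] by (simp add: lower_slack_def \<beta>_def)
  have prod: "expvec \<epsilon> \<alpha> $ i * expvec \<epsilon> \<beta> $ i = s $ i" for i
  proof -
    have "z i = exp (- a / \<epsilon>) * expvec \<epsilon> \<alpha> $ i" "w i = exp (- b / \<epsilon>) / expvec \<epsilon> \<beta> $ i"
      using upper lower upper_slack_eq lower_slack_eq by metis+
    then have "T * (expvec \<epsilon> \<alpha> $ i * expvec \<epsilon> \<beta> $ i) = z i / w i"
      by (simp add: T)
    also have "\<dots> = T * s $ i" using w_pos[of i] by (simp add: z_def)
    finally show ?thesis using T_pos by simp
  qed
  have "flow \<epsilon> C \<eta> \<alpha> \<beta> lam i j = \<eta> $ i $ j - \<eta> $ i $ j / (1 + s $ i * Kmat \<epsilon> C $ i $ j * \<psi> $ j)" for i j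
    by (rule flow_eq_capacity_minus) (simp add: \<psi> prod[symmetric] rho_eq_exp_log_rho)
  then have "(\<Sum>j\<in>UNIV. flow \<epsilon> C \<eta> \<alpha> \<beta> lam i j) = lower_slack \<epsilon> \<beta> b i + ulo $ i" for i
    using s_eq[of i] by (simp add: sum_subtractf lower w_def)
  then have "dual_objective \<epsilon> C \<eta> ulo uup v \<alpha>' \<beta>' lam a b \<le> dual_objective \<epsilon> C \<eta> ulo uup v \<alpha> \<beta> lam a b"
    for \<alpha>' \<beta>'
    by (rule maximal_in_alpha_beta[OF assms(1,2)]) (simp add: upper lower zw)
  with prod show thesis by (rule that)
qed

lemma psi_T_steps_maximize:
  assumes "\<epsilon> > 0" "\<And>i j. \<eta> $ i $ j \<ge> 0"
    and s_pos: "\<And>i. s $ i > 0" and T_pos: "T > 0"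
    and dual: "gas2_dual_variables \<epsilon> ulo uup s \<psi> T \<alpha> \<beta> lam a b"
    and \<psi>_eq: "\<And>j. (\<Sum>i\<in>UNIV. \<eta> $ i $ j / (1 + s $ i * Kmat \<epsilon> C $ i $ j * \<psi> $ j))
        - (\<Sum>i\<in>UNIV. \<eta> $ i $ j) + v $ j = 0"
    and T_eq: "(\<Sum>i\<in>UNIV. (uup $ i - ulo $ i) / (T * s $ i + 1)) - k2 ulo v = 0"
    and same_s: "\<And>i. expvec \<epsilon> \<alpha>' $ i * expvec \<epsilon> \<beta>' $ i = s $ i"
  shows "dual_objective \<epsilon> C \<eta> ulo uup v \<alpha>' \<beta>' lam' a' b' \<le> dual_objective \<epsilon> C \<eta> ulo uup v \<alpha> \<beta> lam a b"
proof -
  have s: "s $ i = expvec \<epsilon> \<alpha> $ i * expvec \<epsilon> \<beta> $ i"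
    and \<psi>: "\<psi> = expvec \<epsilon> lam"
    and upper: "upper_slack \<epsilon> \<alpha> a i = T * s $ i * (uup $ i - ulo $ i) / (T * s $ i + 1)"
    and lower: "lower_slack \<epsilon> \<beta> b i = (uup $ i - ulo $ i) / (T * s $ i + 1)" for i
    using dual
    unfolding gas2_dual_variables_def Let_def upper_slack_eq lower_slack_eq gas2_z_def gas2_w_def
      vec_lambda_beta
    by metis+
  have "flow \<epsilon> C \<eta> \<alpha> \<beta> lam i j = \<eta> $ i $ j - \<eta> $ i $ j / (1 + s $ i * Kmat \<epsilon> C $ i $ j * \<psi> $ j)" for i j
    by (rule flow_eq_capacity_minus) (simp add: \<psi> s rho_eq_exp_log_rho)
  then have column: "(\<Sum>i\<in>UNIV. flow \<epsilon> C \<eta> \<alpha> \<beta> lam i j) = v $ j" for j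
    using \<psi>_eq[of j] by (simp add: sum_subtractf)
  have slack: "upper_slack \<epsilon> \<alpha> a i + lower_slack \<epsilon> \<beta> b i = uup $ i - ulo $ i" for i
  proof -
    have "T * s $ i + 1 > 0" using T_pos s_pos[of i] by (simp add: add_pos_pos)
    moreover have "upper_slack \<epsilon> \<alpha> a i + lower_slack \<epsilon> \<beta> b i
        = (T * s $ i + 1) * (uup $ i - ulo $ i) / (T * s $ i + 1)"
      unfolding upper lower by (simp add: add_divide_distrib[symmetric] distrib_right)
    ultimately show ?thesis by simp
  qed
  have "exp (- (\<alpha>' $ i + \<beta>' $ i) / \<epsilon>) = exp (- (\<alpha> $ i + \<beta> $ i) / \<epsilon>)" for i
    using same_s[of i] s[of i]
    by (simp add: expvec_def exp_add[symmetric] add_divide_distrib diff_divide_distrib)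
  then have "\<alpha>' $ i + \<beta>' $ i = \<alpha> $ i + \<beta> $ i" for i
    using \<open>\<epsilon> > 0\<close> by (metis divide_cancel_right exp_inj_iff less_irrefl neg_equal_iff_equal)
  moreover have "(\<Sum>i\<in>UNIV. lower_slack \<epsilon> \<beta> b i) = k2 ulo v"
    using T_eq by (simp add: lower)
  ultimately show ?thesis
    by (intro maximal_for_fixed_alpha_plus_beta[OF assms(1,2) column slack])
qed

text \<open>
  Real multipliers have positive exponentials, so the recovered slack \<open>w\<^sub>i\<close> is positive.
\<close>

lemma dual_variables_imp_bounds_less:
  assumes "gas2_dual_variables \<epsilon> ulo uup s \<psi> T \<alpha> \<beta> lam a b" "s $ i > 0" "T > 0"
  shows "ulo $ i < uup $ i"
proof -
  have "(uup $ i - ulo $ i) / (T * s $ i + 1) = exp (- b / \<epsilon>) / expvec \<epsilon> \<beta> $ i"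
    using assms(1) unfolding gas2_dual_variables_def Let_def gas2_w_def vec_lambda_beta by blast
  also have "\<dots> > 0" by (simp add: expvec_def)
  finally have "(uup $ i - ulo $ i) / (T * s $ i + 1) > 0" .
  moreover have "T * s $ i + 1 > 0" using assms(2,3) by (simp add: add_pos_pos)
  ultimately show ?thesis by (simp add: zero_less_divide_iff)
qed

section \<open>Limit points of the iteration\<close>

theorem theorem3p3:
  fixes \<epsilon> :: real
    and C \<eta> :: "real^'n^'n"
    and ulo uup v :: "real^'n"
    and s \<psi> :: "nat \<Rightarrow> real^'n" and T :: "nat \<Rightarrow> real"
    and \<alpha> \<beta> lam :: "nat \<Rightarrow> real^'n" and a b :: "nat \<Rightarrow> real"
    and r :: "nat \<Rightarrow> nat"
    and \<alpha>' \<beta>' lam' :: "real^'n" and a' b' :: real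
  assumes "\<epsilon> > 0"
    and "feasible_set \<eta> ulo uup v \<noteq> {}"
    and "gas2_run \<epsilon> C \<eta> ulo uup v s \<psi> T"
    and "\<And>l. l \<ge> 1 \<Longrightarrow>
           gas2_dual_variables \<epsilon> ulo uup (s l) (\<psi> l) (T l) (\<alpha> l) (\<beta> l) (lam l) (a l) (b l)"
    and "strict_mono r"
    and "((\<lambda>l. (\<alpha> l, \<beta> l, lam l, a l, b l)) \<circ> r) \<longlonglongrightarrow> (\<alpha>', \<beta>', lam', a', b')"
  shows "coordinatewise_max (dual_objective \<epsilon> C \<eta> ulo uup v) \<alpha>' \<beta>' lam' a' b'"
proof -
  let ?D = "dual_objective \<epsilon> C \<eta> ulo uup v"
  define V where "V l = ?D (\<alpha> l) (\<beta> l) (lam l) (a l) (b l)" for l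
  note \<epsilon> = \<open>\<epsilon> > 0\<close> and dual = assms(4)
  have \<eta>: "\<eta> $ i $ j \<ge> 0" for i j
  proof -
    obtain \<gamma> u where "(\<gamma>, u) \<in> feasible_set \<eta> ulo uup v" using assms(2) by fast
    then have "0 \<le> \<gamma> $ i $ j \<and> \<gamma> $ i $ j \<le> \<eta> $ i $ j" unfolding feasible_set_def by blast
    then show ?thesis by linarith
  qed
  have pos: "s l $ i > 0" "T l > 0"
    and \<psi>_eq: "(\<Sum>i\<in>UNIV. \<eta> $ i $ j / (1 + s l $ i * Kmat \<epsilon> C $ i $ j * \<psi> l $ j))
        - (\<Sum>i\<in>UNIV. \<eta> $ i $ j) + v $ j = 0"
    and T_eq: "(\<Sum>i\<in>UNIV. (uup $ i - ulo $ i) / (T l * s l $ i + 1)) - k2 ulo v = 0"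
    if l_pos: "l \<ge> 1" for l i j
  proof -
    obtain m where "l = Suc m" using l_pos by (cases l) auto
    then show "s l $ i > 0" "T l > 0"
      "(\<Sum>i\<in>UNIV. \<eta> $ i $ j / (1 + s l $ i * Kmat \<epsilon> C $ i $ j * \<psi> l $ j))
        - (\<Sum>i\<in>UNIV. \<eta> $ i $ j) + v $ j = 0"
      "(\<Sum>i\<in>UNIV. (uup $ i - ulo $ i) / (T l * s l $ i + 1)) - k2 ulo v = 0"
      using assms(3) unfolding gas2_run_def by blast+
  qed
  have s_eq: "(\<Sum>j\<in>UNIV. \<eta> $ i $ j / (1 + s (Suc l) $ i * Kmat \<epsilon> C $ i $ j * \<psi> l $ j))
        - (\<Sum>j\<in>UNIV. \<eta> $ i $ j) + (uup $ i - ulo $ i) / (T l * s (Suc l) $ i + 1) + ulo $ i = 0" for l i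
    using assms(3) unfolding gas2_run_def by blast
  have psi_T_max: "?D \<alpha>'' \<beta>'' lam'' a'' b'' \<le> V l"
    if "l \<ge> 1" "\<And>i. expvec \<epsilon> \<alpha>'' $ i * expvec \<epsilon> \<beta>'' $ i = s l $ i" for l \<alpha>'' \<beta>'' lam'' a'' b''
    unfolding V_def
    by (rule psi_T_steps_maximize[OF \<epsilon> \<eta> pos dual \<psi>_eq T_eq]) (use that in auto)
  \<comment> \<open>The maximizer of the \<open>s\<close>-step and the next iterate have the same \<open>s\<close>, hence the same \<open>\<alpha> + \<beta>\<close>, so
    the two maximizations chain.\<close>
  have next_value: "?D \<alpha>'' \<beta>'' (lam l) (a l) (b l) \<le> V (Suc l)" if "l \<ge> 1" for l \<alpha>'' \<beta>''
  proof -
    have \<psi>: "\<psi> l = expvec \<epsilon> (lam l)" and T: "T l = exp (- a l / \<epsilon>) / exp (- b l / \<epsilon>)"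
      using dual[OF that] by (auto simp: gas2_dual_variables_def Let_def)
    have bounds: "ulo $ i < uup $ i" for i
      by (rule dual_variables_imp_bounds_less[OF dual[OF that] pos[OF that]])
    have s_pos: "s (Suc l) $ i > 0" for i by (rule pos) simp
    obtain \<alpha>1 \<beta>1 where
      prod: "\<And>i. expvec \<epsilon> \<alpha>1 $ i * expvec \<epsilon> \<beta>1 $ i = s (Suc l) $ i" and
      max: "\<And>\<alpha>' \<beta>'. ?D \<alpha>' \<beta>' (lam l) (a l) (b l) \<le> ?D \<alpha>1 \<beta>1 (lam l) (a l) (b l)"
      using s_step_maximizes[where v = v, OF \<epsilon> \<eta> bounds s_pos \<psi> T s_eq] by blast
    have "?D \<alpha>'' \<beta>'' (lam l) (a l) (b l) \<le> ?D \<alpha>1 \<beta>1 (lam l) (a l) (b l)" by (rule max)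
    also have "\<dots> \<le> V (Suc l)" by (rule psi_T_max) (simp_all add: prod)
    finally show ?thesis .
  qed
  have V_step: "V l \<le> V (Suc l)" if "l \<ge> 1" for l
    using next_value[OF that, of "\<alpha> l" "\<beta> l"] by (simp add: V_def)
  have V_mono: "V l \<le> V m" if "1 \<le> l" "l \<le> m" for l m
    using that(2)
  proof (induction rule: dec_induct)
    case (step n)
    then show ?case using V_step[of n] that(1) by linarith
  qed simp
  have r_ge: "l \<le> r l" for l
    by (rule strict_mono_imp_increasing[OF \<open>strict_mono r\<close>])
  note comps = assms(6)[unfolded o_def, THEN tendsto_snd]
  have lims: "(\<lambda>l. \<alpha> (r l)) \<longlonglongrightarrow> \<alpha>'" "(\<lambda>l. \<beta> (r l)) \<longlonglongrightarrow> \<beta>'" "(\<lambda>l. lam (r l)) \<longlonglongrightarrow> lam'"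
    "(\<lambda>l. a (r l)) \<longlonglongrightarrow> a'" "(\<lambda>l. b (r l)) \<longlonglongrightarrow> b'"
    using assms(6)[unfolded o_def, THEN tendsto_fst] comps[THEN tendsto_fst]
      comps[THEN tendsto_snd, THEN tendsto_fst] comps[THEN tendsto_snd, THEN tendsto_snd, THEN tendsto_fst]
      comps[THEN tendsto_snd, THEN tendsto_snd, THEN tendsto_snd]
    by simp_all
  have V_lim: "(\<lambda>l. V (r l)) \<longlonglongrightarrow> ?D \<alpha>' \<beta>' lam' a' b'"
    unfolding V_def by (rule tendsto_dual_objective[OF \<epsilon> lims])
  have V_le: "V l \<le> ?D \<alpha>' \<beta>' lam' a' b'" if "l \<ge> 1" for l
  proof (rule tendsto_lowerbound[OF V_lim])
    show "\<forall>\<^sub>F m in sequentially. V l \<le> V (r m)"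
      using eventually_ge_at_top[of l]
      by eventually_elim (use that r_ge in \<open>blast intro: V_mono order_trans\<close>)
  qed simp
  have alpha_beta_max: "?D \<alpha>'' \<beta>'' lam' a' b' \<le> ?D \<alpha>' \<beta>' lam' a' b'" for \<alpha>'' \<beta>''
  proof (rule tendsto_upperbound)
    show "(\<lambda>l. ?D \<alpha>'' \<beta>'' (lam (r l)) (a (r l)) (b (r l))) \<longlonglongrightarrow> ?D \<alpha>'' \<beta>'' lam' a' b'"
      by (intro tendsto_dual_objective[OF \<epsilon>] tendsto_const lims)
    show "\<forall>\<^sub>F l in sequentially. ?D \<alpha>'' \<beta>'' (lam (r l)) (a (r l)) (b (r l)) \<le> ?D \<alpha>' \<beta>' lam' a' b'"
      using eventually_ge_at_top[of 1]
    proof eventually_elim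
      case (elim l)
      then have "r l \<ge> 1" using r_ge[of l] by linarith
      then show ?case using next_value[of "r l"] V_le[of "Suc (r l)"] by (meson le_SucI order_trans)
    qed
  qed simp
  have lam_a_b_max: "?D \<alpha>' \<beta>' lam'' a'' b'' \<le> ?D \<alpha>' \<beta>' lam' a' b'" for lam'' a'' b''
  proof (rule tendsto_le[OF _ V_lim])
    show "(\<lambda>l. ?D (\<alpha> (r l)) (\<beta> (r l)) lam'' a'' b'') \<longlonglongrightarrow> ?D \<alpha>' \<beta>' lam'' a'' b''"
      by (intro tendsto_dual_objective[OF \<epsilon>] tendsto_const lims)
    show "\<forall>\<^sub>F l in sequentially. ?D (\<alpha> (r l)) (\<beta> (r l)) lam'' a'' b'' \<le> V (r l)"
      using eventually_ge_at_top[of 1]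
    proof eventually_elim
      case (elim l)
      then have "r l \<ge> 1" using r_ge[of l] by linarith
      then show ?case
        using dual[of "r l"] by (intro psi_T_max) (simp_all add: gas2_dual_variables_def Let_def)
    qed
  qed simp
  show ?thesis
    unfolding coordinatewise_max_def using alpha_beta_max lam_a_b_max by blast
qed

end
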